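(* Let $\Gamma\subset SL_2(\mathbb R)$ be a Fuchsian group of the first kind and let $m\ge2$ be even. Suppose that $\mathfrak a_\infty$ is a cusp for $\Gamma$. Let $f_1,\ldots,f_k\in M_m(\Gamma)$ be a sequence of linearly independent modular forms. Consider $f_1,\ldots,f_k$ as meromorphic functions in the variable $q$ in a neighborhood of $q=0$. Then $$\nu_{\mathfrak a_\infty}\left(W(f_1,\ldots,f_k)\right)=\nu_{q-0}(f_1,\ldots,f_k).$$
   Context: A Fuchsian group of the first kind is a discrete subgroup $\Gamma\subset SL_2(\mathbb R)$ with $\iint_{\Gamma\backslash\mathbb H} dx\,dy/y^2<\infty$, $\mathbb H$ being the upper half-plane. For $g=\begin{pmatrix}a&b\\c&d\end{pmatrix}$ put $j(g,z)=cz+d$. $\mathfrak R_\Gamma$ is the compact Riemann surface obtained from $\Gamma\backslash\mathbb H$ by adding the finitely many $\Gamma$-orbits of cusps. $M_m(\Gamma)$ is the space of holomorphic $f:\mathbb H\to\mathbb C$ with $f(\gamma.z)=j(\gamma,z)^m f(z)$ for all $\gamma\in\Gamma$ that are holomorphic at every cusp of $\Gamma$. "$\mathfrak a_\infty$ is a cusp for $\Gamma$" means that $\infty$ is a cusp of $\Gamma$ and $\mathfrak a_\infty\in\mathfrak R_\Gamma$ is the corresponding point. Let $h>0$ be the width of this cusp, i.e. $\{\pm1\}\Gamma_\infty=\{\pm1\}\{\begin{pmatrix}1&lh\\0&1\end{pmatrix}:l\in\mathbb Z\}$, and $q=\exp(2\pi\sqrt{-1}z/h)$. For a non-zero modular form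 $f$ of even weight for $\Gamma$ with $q$-expansion $f=\sum_{n\ge0}a_nq^n$, $\nu_{\mathfrak a_\infty}(f)$ is the least $n$ with $a_n\ne0$. The Wronskian is taken with respect to $z$: $W(f_1,\ldots,f_k)=\det\left(\frac{d^{i-1}f_j}{dz^{i-1}}\right)_{1\le i,j\le k}$; it is a modular form for $\Gamma$ of weight $k(m+k-1)$, non-zero when $f_1,\ldots,f_k$ are linearly independent. For linearly independent functions $\varphi_1,\ldots,\varphi_k$ of $q$, holomorphic at $q=0$, with $\mathbb C$-span $A$, the set $\{\nu_{q-0}(\varphi):\varphi\in A,\ \varphi\ne0\}$ of orders of vanishing at $q=0$ has exactly $k=\dim A$ different elements; $\nu_{q-0}(\varphi_1,\ldots,\varphi_k)$ denotes the sum of these $k$ values. *)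

theory Defs
  imports
    "Jordan_Normal_Form.Determinant"
    "HOL-Complex_Analysis.Complex_Analysis"
begin

no_notation vec_index (infixl "$" 100)
no_notation fps_nth (infixl "$" 75)

section \<open>Fuchsian groups of the first kind\<close>

text \<open>
  Both \<^theory>\<open>HOL-Analysis.Determinants\<close> and \<^theory>\<open>Jordan_Normal_Form.Determinant\<close> are
  loaded: \<open>2 \<times> 2\<close> real matrices use the former (whose type carries the topology needed for
  discreteness), Wronskians, whose size is a number, the latter.
\<close>

definition SL2R :: "(real ^ 2 ^ 2) monoid" where
  "SL2R = \<lparr>carrier = {A. Determinants.det A = 1}, mult = (**), one = Finite_Cartesian_Product.mat 1\<rparr>"

definition upper_half_plane :: "complex set" where
  "upper_half_plane = {z. Im z > 0}"

definition moebius :: "real ^ 2 ^ 2 \<Rightarrow> complex \<Rightarrow> complex" where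
  "moebius g z = (of_real (g $ 1 $ 1) * z + of_real (g $ 1 $ 2)) /
                 (of_real (g $ 2 $ 1) * z + of_real (g $ 2 $ 2))"

definition aut_factor :: "real ^ 2 ^ 2 \<Rightarrow> complex \<Rightarrow> complex" where
  "aut_factor g z = of_real (g $ 2 $ 1) * z + of_real (g $ 2 $ 2)"

definition hyperbolic_area :: "complex set \<Rightarrow> ennreal" where
  "hyperbolic_area F = (\<integral>\<^sup>+z\<in>F. ennreal (1 / (Im z)\<^sup>2) \<partial>lborel)"

text \<open>
  The area of \<open>\<Gamma>\<setminus>\<H>\<close> is the hyperbolic area of a Borel set containing exactly one
  point of each orbit. For discrete \<open>\<Gamma>\<close> such a set exists, and the area does not depend on it.
\<close>

definition orbit_representatives :: "(real ^ 2 ^ 2) set \<Rightarrow> complex set \<Rightarrow> bool" where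
  "orbit_representatives \<Gamma> F \<longleftrightarrow>
     F \<in> sets borel \<and> F \<subseteq> upper_half_plane \<and>
     (\<forall>z\<in>upper_half_plane. \<exists>!w. w \<in> F \<and> (\<exists>g\<in>\<Gamma>. w = moebius g z))"

definition fuchsian_first_kind :: "(real ^ 2 ^ 2) set \<Rightarrow> bool" where
  "fuchsian_first_kind \<Gamma> \<longleftrightarrow>
     subgroup \<Gamma> SL2R \<and> discrete \<Gamma> \<and>
     (\<exists>F. orbit_representatives \<Gamma> F \<and> hyperbolic_area F < \<infinity>)"

section \<open>Cusps\<close>

datatype boundary_point = Infinity | Finite real

fun moebius_boundary :: "real ^ 2 ^ 2 \<Rightarrow> boundary_point \<Rightarrow> boundary_point" where
  "moebius_boundary g Infinity =
     (if g $ 2 $ 1 = 0 then Infinity else Finite (g $ 1 $ 1 / g $ 2 $ 1))"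
| "moebius_boundary g (Finite x) =
     (if g $ 2 $ 1 * x + g $ 2 $ 2 = 0 then Infinity
      else Finite ((g $ 1 $ 1 * x + g $ 1 $ 2) / (g $ 2 $ 1 * x + g $ 2 $ 2)))"

definition parabolic :: "real ^ 2 ^ 2 \<Rightarrow> bool" where
  "parabolic g \<longleftrightarrow> Determinants.det g = 1 \<and> \<bar>trace g\<bar> = 2 \<and>
     g \<noteq> Finite_Cartesian_Product.mat 1 \<and> g \<noteq> - Finite_Cartesian_Product.mat 1"

definition is_cusp :: "(real ^ 2 ^ 2) set \<Rightarrow> boundary_point \<Rightarrow> bool" where
  "is_cusp \<Gamma> x \<longleftrightarrow> (\<exists>g\<in>\<Gamma>. parabolic g \<and> moebius_boundary g x = x)"

definition translation :: "real \<Rightarrow> real ^ 2 ^ 2" where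
  "translation t = vector [vector [1, t], vector [0, 1]]"

text \<open>The width of the cusp \<open>\<infinity>\<close>, specified by
  \<open>{\<plusminus>1} \<Gamma>\<^sub>\<infinity> = {\<plusminus>1} {translation (l h) | l \<in> \<int>}\<close>.\<close>

definition cusp_width :: "(real ^ 2 ^ 2) set \<Rightarrow> real" where
  "cusp_width \<Gamma> = (THE h. h > 0 \<and>
     {g. \<exists>\<gamma>\<in>\<Gamma>. moebius_boundary \<gamma> Infinity = Infinity \<and> (g = \<gamma> \<or> g = - \<gamma>)} =
     {g. \<exists>l::int. g = translation (of_int l * h) \<or> g = - translation (of_int l * h)})"

section \<open>Expansions in \<open>q = exp (2 \<pi> i z / h)\<close>\<close>

definition has_q_expansion :: "real \<Rightarrow> (complex \<Rightarrow> complex) \<Rightarrow> complex fps \<Rightarrow> bool" where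
  "has_q_expansion h f A \<longleftrightarrow>
     (\<forall>z\<in>upper_half_plane.
        (\<lambda>n. fps_nth A n * exp (2 * of_real pi * \<i> * z / of_real h) ^ n) sums f z)"

definition q_expansion :: "real \<Rightarrow> (complex \<Rightarrow> complex) \<Rightarrow> complex fps" where
  "q_expansion h f = (THE A. has_q_expansion h f A)"

text \<open>\<open>f\<close> as a function of \<open>q\<close>; only its values on the unit disc are meaningful.\<close>

definition as_function_of_q :: "real \<Rightarrow> (complex \<Rightarrow> complex) \<Rightarrow> complex \<Rightarrow> complex" where
  "as_function_of_q h f = eval_fps (q_expansion h f)"

definition order_at_infinity :: "(real ^ 2 ^ 2) set \<Rightarrow> (complex \<Rightarrow> complex) \<Rightarrow> nat" where
  "order_at_infinity \<Gamma> f = subdegree (q_expansion (cusp_width \<Gamma>) f)"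

section \<open>Modular forms\<close>

definition slash :: "nat \<Rightarrow> (complex \<Rightarrow> complex) \<Rightarrow> real ^ 2 ^ 2 \<Rightarrow> complex \<Rightarrow> complex" where
  "slash m f g z = f (moebius g z) / aut_factor g z ^ m"

definition conjugate_group :: "real ^ 2 ^ 2 \<Rightarrow> (real ^ 2 ^ 2) set \<Rightarrow> (real ^ 2 ^ 2) set" where
  "conjugate_group \<sigma> \<Gamma> = (\<lambda>\<gamma>. matrix_inv \<sigma> ** \<gamma> ** \<sigma>) ` \<Gamma>"

text \<open>
  Holomorphy at a cusp \<open>\<sigma> \<infinity>\<close>: the transform of \<open>f\<close> by \<open>\<sigma>\<close> has an expansion without negative
  powers in the parameter \<open>q\<close> of \<open>\<sigma>\<^sup>-\<^sup>1 \<Gamma> \<sigma>\<close>. This is the right condition only for even \<open>m\<close>, where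
  \<open>\<plusminus>g\<close> act in the same way. Functions are total; only values on the upper half-plane matter.
\<close>

definition modular_forms :: "(real ^ 2 ^ 2) set \<Rightarrow> nat \<Rightarrow> (complex \<Rightarrow> complex) set" where
  "modular_forms \<Gamma> m = {f. f holomorphic_on upper_half_plane \<and>
     (\<forall>\<gamma>\<in>\<Gamma>. \<forall>z\<in>upper_half_plane. f (moebius \<gamma> z) = aut_factor \<gamma> z ^ m * f z) \<and>
     (\<forall>\<sigma>\<in>carrier SL2R. is_cusp \<Gamma> (moebius_boundary \<sigma> Infinity) \<longrightarrow>
        (\<exists>A. has_q_expansion (cusp_width (conjugate_group \<sigma> \<Gamma>)) (slash m f \<sigma>) A))}"

definition linearly_independent_on ::
    "complex set \<Rightarrow> nat \<Rightarrow> (nat \<Rightarrow> complex \<Rightarrow> complex) \<Rightarrow> bool" where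
  "linearly_independent_on S k f \<longleftrightarrow>
     (\<forall>c :: nat \<Rightarrow> complex. (\<forall>z\<in>S. (\<Sum>j<k. c j * f j z) = 0) \<longrightarrow> (\<forall>j<k. c j = 0))"

section \<open>Wronskians and orders of vanishing\<close>

text \<open>Rows and columns are numbered from \<open>0\<close>.\<close>

definition wronskian :: "nat \<Rightarrow> (nat \<Rightarrow> complex \<Rightarrow> complex) \<Rightarrow> complex \<Rightarrow> complex" where
  "wronskian k f z = Determinant.det (Matrix.mat k k (\<lambda>(i, j). (deriv ^^ i) (f j) z))"

definition complex_span :: "nat \<Rightarrow> (nat \<Rightarrow> complex \<Rightarrow> complex) \<Rightarrow> (complex \<Rightarrow> complex) set" where
  "complex_span k \<phi> = {(\<lambda>q. \<Sum>j<k. c j * \<phi> j q) | c :: nat \<Rightarrow> complex. True}"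

text \<open>
  The sum of the distinct orders at \<open>0\<close> of the non-zero elements of the span. Non-zero means
  non-zero as a germ at \<open>0\<close>. For functions holomorphic at \<open>0\<close> with linearly independent
  germs there are exactly \<open>k\<close> such orders, so the sum is over a finite set.
\<close>

definition order_sum_at_0 :: "nat \<Rightarrow> (nat \<Rightarrow> complex \<Rightarrow> complex) \<Rightarrow> int" where
  "order_sum_at_0 k \<phi> =
     \<Sum> {zorder \<psi> 0 | \<psi>. \<psi> \<in> complex_span k \<phi> \<and> (\<exists>\<^sub>F q in nhds 0. \<psi> q \<noteq> 0)}"

end

theory Submission
  imports Defs
begin

text \<open>
  Write \<open>h\<close> for the width of the cusp \<open>\<infinity>\<close> and \<open>q = exp (2 \<pi> i z / h)\<close>. By the chain rule
  \<open>d/dz = c q d/dq\<close> with \<open>c = 2 \<pi> i / h\<close>, so the \<open>q\<close>-expansion of the Wronskian with respect to \<open>z\<close> is the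
  determinant of the power series \<open>(c q d/dq)\<^sup>i A\<^sub>j\<close>, where \<open>A\<^sub>j\<close> is the expansion of \<open>f\<^sub>j\<close>
  (\<open>has_q_expansion_wronskian\<close>). The theorem thus becomes a statement on formal power series:
  the order of this determinant is the sum of the orders that occur in the span of the \<open>A\<^sub>j\<close>
  (\<open>subdegree_det_theta_matrix\<close>).

  The span has a basis \<open>b\<^sub>l\<close> whose orders \<open>n\<^sub>l\<close> are distinct and are all the orders that occur
  (\<open>basis_with_distinct_orders\<close>). A change of basis multiplies the determinant by a non-zero constant.
  For the basis \<open>b\<^sub>l\<close> the operator \<open>c q d/dq\<close> multiplies \<open>q\<^sup>n\<close> by \<open>c n\<close>; so \<open>q\<close> to the power
  \<open>n\<^sub>1 + \<dots> + n\<^sub>k\<close> splits off from the determinant, and the constant term of the cofactor is, up to the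
  leading coefficients, the Vandermonde determinant of the distinct numbers \<open>c n\<^sub>l\<close>
  (\<open>subdegree_det_theta_matrix_distinct\<close>).

  On the analytic side, the orders at \<open>q = 0\<close> of the functions in the span are the orders of their power
  series (\<open>order_sum_at_0_eq\<close>). All this presupposes that \<open>h\<close> is a positive number, that is, that the
  stabilizer of \<open>\<infinity>\<close> in a discrete group with a cusp at \<open>\<infinity>\<close> is, up to sign, an infinite cyclic group of
  translations (\<open>cusp_width_pos\<close>).
\<close>

section \<open>Wronskians of formal power series\<close>

text \<open>
  With \<open>q = exp (2 \<pi> i z / h)\<close>, the derivation \<open>d/dz\<close> becomes \<open>c q d/dq\<close> on power series in \<open>q\<close>, where
  \<open>c = 2 \<pi> i / h\<close>.
\<close>
definition theta :: "'a :: comm_ring_1 \<Rightarrow> 'a fps \<Rightarrow> 'a fps" where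
  "theta c F = fps_const c * fps_X * fps_deriv F"

text \<open>
  The monomials are eigenvectors of \<open>theta c\<close>. Hence, in contrast with \<open>d/dq\<close>, it never lowers the order
  of vanishing, and this is why the Wronskian with respect to \<open>z\<close> has a clean order at the cusp.
\<close>
lemma nth_theta_funpow:
  "fps_nth ((theta c ^^ i) F) n = (c * of_nat n) ^ i * fps_nth F n"
proof (induction i)
  case (Suc i)
  have "fps_nth (theta c G) n = c * of_nat n * fps_nth G n" for G :: "'a fps"
    by (cases n) (auto simp: theta_def mult.assoc)
  with Suc show ?case
    by (simp add: mult.assoc)
qed simp

lemma theta_funpow_linear:
  "(theta c ^^ i) (\<Sum>l\<in>L. fps_const (x l) * F l) = (\<Sum>l\<in>L. fps_const (x l) * (theta c ^^ i) (F l))"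
  by (rule fps_ext) (simp add: nth_theta_funpow fps_sum_nth sum_distrib_left mult_ac)

definition theta_matrix :: "nat \<Rightarrow> 'a :: comm_ring_1 \<Rightarrow> (nat \<Rightarrow> 'a fps) \<Rightarrow> 'a fps mat" where
  "theta_matrix k c F = Matrix.mat k k (\<lambda>(i, j). (theta c ^^ i) (F j))"

lemma theta_matrix_carrier [simp]: "theta_matrix k c F \<in> carrier_mat k k"
  by (simp add: theta_matrix_def)

text \<open>
  A Vandermonde matrix with rescaled columns: a vector annihilated by the transpose would be the
  coefficient vector of a non-zero polynomial of degree less than \<open>k\<close> with the \<open>k\<close> roots \<open>x l\<close>.
\<close>
lemma det_power_matrix_nonzero:
  fixes x y :: "nat \<Rightarrow> 'a :: idom"
  assumes inj: "inj_on x {..<k}" and nz: "\<And>l. l < k \<Longrightarrow> y l \<noteq> 0"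
  shows "Determinant.det (Matrix.mat k k (\<lambda>(i, l). x l ^ i * y l)) \<noteq> 0"
proof
  let ?M = "Matrix.mat k k (\<lambda>(i, l). x l ^ i * y l)"
  assume "Determinant.det ?M = 0"
  then have "Determinant.det (transpose_mat ?M) = 0"
    by (simp add: Determinant.det_transpose[of _ k])
  then obtain v where v: "v \<in> carrier_vec k" "v \<noteq> 0\<^sub>v k" "transpose_mat ?M *\<^sub>v v = 0\<^sub>v k"
    using det_0_iff_vec_prod_zero[of "transpose_mat ?M" k] by auto
  define p where "p = (\<Sum>i<k. monom (vec_index v i) i)"
  have coeff_p: "poly.coeff p i = (if i < k then vec_index v i else 0)" for i
    by (simp add: p_def coeff_sum)
  have "poly p (x l) = 0" if l: "l < k" for l
  proof -
    have "0 = vec_index (transpose_mat ?M *\<^sub>v v) l"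
      using v(3) l by simp
    also have "\<dots> = (\<Sum>i<k. x l ^ i * y l * vec_index v i)"
      using l v(1) by (simp add: scalar_prod_def lessThan_atLeast0)
    also have "\<dots> = y l * poly p (x l)"
      by (simp add: p_def poly_sum poly_monom sum_distrib_left mult_ac)
    finally show ?thesis
      using nz[OF l] by simp
  qed
  then have roots: "x ` {..<k} \<subseteq> {z. poly p z = 0}"
    by auto
  have "p \<noteq> 0"
  proof
    assume "p = 0"
    then have "vec_index v i = 0" if "i < k" for i
      using coeff_p[of i] that by simp
    with v(1,2) show False
      by (auto intro: eq_vecI)
  qed
  then have "k \<le> Polynomial.degree p"
    using card_mono[OF poly_roots_finite roots] card_poly_roots_bound[of p]
    by (simp add: card_image[OF inj])
  with coeff_p[of "Polynomial.degree p"] \<open>p \<noteq> 0\<close> show False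
    by simp
qed

text \<open>
  Column \<open>l\<close> is divisible by \<open>q\<close> to the power \<open>subdegree (b l)\<close>. After these powers are pulled out of
  the determinant, the constant term of what remains is a Vandermonde determinant in the numbers
  \<open>c * subdegree (b l)\<close>, scaled by the leading coefficients. It does not vanish because the orders are
  distinct and the characteristic is zero.
\<close>
lemma subdegree_det_theta_matrix_distinct:
  fixes b :: "nat \<Rightarrow> 'a :: field_char_0 fps"
  assumes c: "c \<noteq> 0" and nz: "\<And>l. l < k \<Longrightarrow> b l \<noteq> 0"
    and inj: "inj_on (\<lambda>l. subdegree (b l)) {..<k}"
  shows "Determinant.det (theta_matrix k c b) \<noteq> 0"
    and "subdegree (Determinant.det (theta_matrix k c b)) = (\<Sum>l<k. subdegree (b l))"
proof -
  define n where "n l = subdegree (b l)" for l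
  define E where "E = Matrix.mat k k (\<lambda>(i, l). fps_shift (n l) ((theta c ^^ i) (b l)))"
  have E: "E \<in> carrier_mat k k"
    by (simp add: E_def)
  have entry: "theta_matrix k c b $$ (i, l) = E $$ (i, l) * fps_X ^ n l" if "i < k" "l < k" for i l
  proof -
    have "(theta c ^^ i) (b l) = fps_shift (n l) ((theta c ^^ i) (b l)) * fps_X ^ n l"
      by (rule fps_ext) (auto simp: nth_theta_funpow fps_X_power_mult_right_nth n_def)
    with that show ?thesis
      by (simp add: theta_matrix_def E_def)
  qed
  have det_eq: "Determinant.det (theta_matrix k c b) = Determinant.det E * fps_X ^ (\<Sum>l<k. n l)"
  proof -
    have "(\<Prod>i = 0..<k. theta_matrix k c b $$ (i, p i)) =
        (\<Prod>i = 0..<k. E $$ (i, p i)) * fps_X ^ (\<Sum>l<k. n l)" if p: "p permutes {0..<k}" for p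
    proof -
      have "(\<Prod>i = 0..<k. theta_matrix k c b $$ (i, p i)) =
          (\<Prod>i = 0..<k. E $$ (i, p i) * fps_X ^ n (p i))"
        using permutes_in_image[OF p] by (intro prod.cong) (auto intro!: entry)
      also have "\<dots> = (\<Prod>i = 0..<k. E $$ (i, p i)) * (\<Prod>i = 0..<k. fps_X ^ n (p i))"
        by (rule prod.distrib)
      also have "(\<Prod>i = 0..<k. fps_X ^ n (p i) :: 'a fps) = (\<Prod>l = 0..<k. fps_X ^ n l)"
        using prod.permute[OF p, of "\<lambda>l. fps_X ^ n l :: 'a fps"] by (simp add: o_def)
      finally show ?thesis
        by (simp add: power_sum lessThan_atLeast0)
    qed
    then show ?thesis
      by (auto simp: det_def'[of _ k] E sum_distrib_right mult.assoc intro!: sum.cong)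
  qed
  interpret nth_0: comm_ring_hom "\<lambda>F :: 'a fps. fps_nth F 0"
    by unfold_locales simp_all
  have "map_mat (\<lambda>F. fps_nth F 0) E = Matrix.mat k k (\<lambda>(i, l). (c * of_nat (n l)) ^ i * fps_nth (b l) (n l))"
    by (rule eq_matI) (auto simp: E_def nth_theta_funpow)
  moreover have "Determinant.det (Matrix.mat k k (\<lambda>(i, l). (c * of_nat (n l)) ^ i * fps_nth (b l) (n l))) \<noteq> 0"
  proof (rule det_power_matrix_nonzero)
    show "inj_on (\<lambda>l. c * of_nat (n l)) {..<k}"
      using inj c by (auto simp: inj_on_def n_def)
    show "fps_nth (b l) (n l) \<noteq> 0" if "l < k" for l
      using nz[OF that] by (simp add: n_def)
  qed
  ultimately have E0: "fps_nth (Determinant.det E) 0 \<noteq> 0"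
    by (metis nth_0.hom_det)
  then have "Determinant.det E \<noteq> 0"
    by auto
  then show "Determinant.det (theta_matrix k c b) \<noteq> 0"
    by (simp add: det_eq)
  show "subdegree (Determinant.det (theta_matrix k c b)) = (\<Sum>l<k. subdegree (b l))"
    using E0 \<open>Determinant.det E \<noteq> 0\<close> by (simp add: det_eq n_def subdegree_eq_0)
qed

definition fps_combination :: "nat \<Rightarrow> (nat \<Rightarrow> 'a :: comm_ring_1 fps) \<Rightarrow> (nat \<Rightarrow> 'a) \<Rightarrow> 'a fps" where
  "fps_combination k F x = (\<Sum>j<k. fps_const (x j) * F j)"

definition fps_independent :: "nat \<Rightarrow> (nat \<Rightarrow> 'a :: comm_ring_1 fps) \<Rightarrow> bool" where
  "fps_independent k F \<longleftrightarrow> (\<forall>x. fps_combination k F x = 0 \<longrightarrow> (\<forall>j<k. x j = 0))"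

definition span_orders :: "nat \<Rightarrow> (nat \<Rightarrow> 'a :: comm_ring_1 fps) \<Rightarrow> nat set" where
  "span_orders k F = {subdegree (fps_combination k F x) | x. fps_combination k F x \<noteq> 0}"

text \<open>
  Pick one element of the span for each order that occurs. Such elements are independent, since the
  term of least order in a linear combination cannot cancel. They also span: subtracting suitable
  multiples of them from an element of the span clears its coefficients one after another, and beyond the
  largest order only zero is left. Comparing the two bases shows that exactly \<open>k\<close> orders occur.
\<close>
lemma basis_with_distinct_orders:
  fixes F :: "nat \<Rightarrow> 'a :: field fps"
  assumes indep: "fps_independent k F"
  obtains b :: "nat \<Rightarrow> 'a fps" and x :: "nat \<Rightarrow> nat \<Rightarrow> 'a"
  where "\<And>l. l < k \<Longrightarrow> b l \<noteq> 0"
    and "bij_betw (\<lambda>l. subdegree (b l)) {..<k} (span_orders k F)"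
    and "\<And>j. j < k \<Longrightarrow> F j = fps_combination k b (\<lambda>l. x l j)"
proof -
  interpret vs: vector_space "\<lambda>(a::'a) F. fps_const a * F"
    by unfold_locales (auto simp: algebra_simps simp flip: fps_const_add fps_const_mult)
  define S where "S = span_orders k F"
  define V where "V = vs.span (F ` {..<k})"
  have comb_in_V: "fps_combination k F x \<in> V" for x
    unfolding fps_combination_def V_def by (intro vs.span_sum vs.span_scale vs.span_base) auto
  \<comment> \<open>The vector space library speaks of independent sets, not families, so injectivity has to be
    known before independence can be transferred.\<close>
  have inj_F: "inj_on F {..<k}"
  proof (rule inj_onI, rule ccontr)
    fix i j assume ij: "i \<in> {..<k}" "j \<in> {..<k}" "F i = F j" "i \<noteq> j"
    define x :: "nat \<Rightarrow> 'a" where "x l = (if l = i then 1 else if l = j then -1 else 0)" for l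
    have "fps_combination k F x = (\<Sum>l\<in>{i, j}. fps_const (x l) * F l)"
      unfolding fps_combination_def using ij by (intro sum.mono_neutral_right) (auto simp: x_def)
    also have "\<dots> = 0"
      using ij by (simp add: x_def flip: fps_const_neg)
    finally have "x i = 0"
      using indep ij by (auto simp: fps_independent_def)
    then show False
      by (simp add: x_def)
  qed
  have V_comb: "\<exists>x. v = fps_combination k F x" if "v \<in> V" for v
  proof -
    obtain u where "v = (\<Sum>w\<in>F ` {..<k}. fps_const (u w) * w)"
      using \<open>v \<in> V\<close> unfolding V_def by (auto simp: vs.span_finite)
    also have "\<dots> = fps_combination k F (\<lambda>j. u (F j))"
      unfolding fps_combination_def by (subst sum.reindex[OF inj_F]) simp
    finally show ?thesis
      by blast
  qed
  have S_V: "subdegree v \<in> S" if "v \<in> V" "v \<noteq> 0" for v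
    using V_comb[OF that(1)] that(2) by (auto simp: S_def span_orders_def)
  have "\<exists>v. v \<in> V \<and> v \<noteq> 0 \<and> subdegree v = s" if "s \<in> S" for s
    using that comb_in_V by (auto simp: S_def span_orders_def)
  then obtain B where B: "B s \<in> V" "B s \<noteq> 0" "subdegree (B s) = s" if "s \<in> S" for s
    by metis
  have indep_F: "vs.independent (F ` {..<k})"
  proof
    assume "vs.dependent (F ` {..<k})"
    then obtain u where u: "\<exists>w\<in>F ` {..<k}. u w \<noteq> 0" "(\<Sum>w\<in>F ` {..<k}. fps_const (u w) * w) = 0"
      by (auto simp: vs.dependent_finite)
    have "fps_combination k F (\<lambda>j. u (F j)) = 0"
      using u(2) unfolding fps_combination_def by (subst (asm) sum.reindex[OF inj_F]) simp
    then show False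
      using u(1) indep by (auto simp: fps_independent_def)
  qed
  \<comment> \<open>Look at the coefficient of a relation at the least order that occurs in it with a
    non-zero scalar.\<close>
  have indep_B: "vs.independent (B ` S)"
    unfolding vs.independent_explicit_finite_subsets
  proof (intro allI impI ballI, rule ccontr)
    fix T u w
    assume T: "T \<subseteq> B ` S" "finite T" "(\<Sum>v\<in>T. fps_const (u v) * v) = 0" and w: "w \<in> T" "u w \<noteq> 0"
    define T' where "T' = {v\<in>T. u v \<noteq> 0}"
    have T': "finite T'" "T' \<noteq> {}"
      using T(2) w by (auto simp: T'_def)
    obtain v where v: "v \<in> T'" "\<And>v'. v' \<in> T' \<Longrightarrow> subdegree v \<le> subdegree v'"
      using arg_min_if_finite(1)[OF T'] arg_min_least[OF T'] by metis
    have v_nz: "v \<in> T" "u v \<noteq> 0" "v \<noteq> 0"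
      using v(1) T(1) B by (auto simp: T'_def)
    have "u v' * fps_nth v' (subdegree v) = 0" if v': "v' \<in> T" "v' \<noteq> v" for v'
    proof (cases "u v' = 0")
      case False
      then have "subdegree v \<le> subdegree v'"
        using v' v(2) by (auto simp: T'_def)
      moreover have "subdegree v \<noteq> subdegree v'"
      proof
        assume eq: "subdegree v = subdegree v'"
        obtain s s' where s: "s \<in> S" "v = B s" "s' \<in> S" "v' = B s'"
          using v'(1) v_nz(1) T(1) by blast
        with eq B(3) have "s = s'"
          by simp
        with s v'(2) show False
          by simp
      qed
      ultimately have "subdegree v < subdegree v'"
        by linarith
      then have "fps_nth v' (subdegree v) = 0"
        by (rule nth_less_subdegree_zero)
      then show ?thesis
        by simp
    qed simp
    then have "(\<Sum>v'\<in>T - {v}. u v' * fps_nth v' (subdegree v)) = 0"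
      by (intro sum.neutral) blast
    then have "(\<Sum>v'\<in>T. u v' * fps_nth v' (subdegree v)) = u v * fps_nth v (subdegree v)"
      by (simp add: sum.remove[OF T(2) v_nz(1)])
    moreover have "(\<Sum>v'\<in>T. u v' * fps_nth v' (subdegree v)) = 0"
      using arg_cong[OF T(3), of "\<lambda>G. fps_nth G (subdegree v)"] by (simp add: fps_sum_nth)
    ultimately show False
      using v_nz by simp
  qed
  have B_sub_V: "B ` S \<subseteq> V"
    using B by auto
  have fin: "finite (B ` S)" "card (B ` S) \<le> card (F ` {..<k})"
    using vs.independent_span_bound[OF _ indep_B, of "F ` {..<k}"] B_sub_V by (auto simp: V_def)
  have inj_B: "inj_on B S"
    using B(3) by (metis inj_onI)
  have fin_S: "finite S"
    using fin(1) inj_B by (simp add: finite_image_iff)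
  have V_span: "V \<subseteq> vs.span (B ` S)"
  proof
    fix v assume v: "v \<in> V"
    \<comment> \<open>If the first \<open>N\<close> coefficients are cleared but the next one is not, then \<open>N\<close> is itself an
      order of the span, so there is a basis element to subtract.\<close>
    have approx: "\<exists>u\<in>vs.span (B ` S). \<forall>i<N. fps_nth (v - u) i = 0" for N
    proof (induction N)
      case 0
      show ?case
        using vs.span_zero by blast
    next
      case (Suc N)
      then obtain u where u: "u \<in> vs.span (B ` S)" "\<And>i. i < N \<Longrightarrow> fps_nth (v - u) i = 0"
        by auto
      show ?case
      proof (cases "fps_nth (v - u) N = 0")
        case True
        then show ?thesis
          using u less_Suc_eq by metis
      next
        case False
        have "v - u \<in> V"
          using v u(1) vs.span_minimal[OF B_sub_V] unfolding V_def
          by (auto intro: vs.span_diff)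
        moreover have sub: "subdegree (v - u) = N"
          using False u(2) by (rule subdegreeI)
        ultimately have N: "N \<in> S"
          using S_V[of "v - u"] False by fastforce
        define a where "a = fps_nth (v - u) N / fps_nth (B N) N"
        have lead: "fps_nth (B N) N \<noteq> 0"
          using B(2,3)[OF N] by (metis nth_subdegree_nonzero)
        have "fps_nth (v - (u + fps_const a * B N)) i = 0" if "i < Suc N" for i
        proof (cases "i = N")
          case True
          then show ?thesis
            using lead by (simp add: a_def)
        next
          case False
          then have "i < N"
            using that by simp
          then have "fps_nth (v - u) i = 0"
            by (rule u(2))
          moreover have "fps_nth (B N) i = 0"
            using \<open>i < N\<close> by (intro nth_less_subdegree_zero) (simp only: B(3)[OF N])
          ultimately show ?thesis
            by simp
        qed
        moreover have "u + fps_const a * B N \<in> vs.span (B ` S)"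
          by (rule vs.span_add[OF u(1) vs.span_scale[OF vs.span_base[OF imageI[OF N]]]])
        ultimately show ?thesis
          by blast
      qed
    qed
    \<comment> \<open>The insertion of \<open>0\<close> only makes the maximum meaningful when \<open>S\<close> is empty.\<close>
    obtain u where u: "u \<in> vs.span (B ` S)" "\<forall>i<Suc (Max (insert 0 S)). fps_nth (v - u) i = 0"
      using approx by blast
    have "v - u = 0"
    proof (rule ccontr)
      assume nz: "v - u \<noteq> 0"
      have "v - u \<in> V"
        using v u(1) vs.span_minimal[OF B_sub_V] unfolding V_def by (auto intro: vs.span_diff)
      then have "subdegree (v - u) \<in> S"
        using S_V nz by blast
      then have "subdegree (v - u) < Suc (Max (insert 0 S))"
        using fin_S by (simp add: less_Suc_eq_le)
      then show False
        using u(2) nz nth_subdegree_nonzero by blast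
    qed
    then show "v \<in> vs.span (B ` S)"
      using u(1) by simp
  qed
  have F_span: "F ` {..<k} \<subseteq> vs.span (B ` S)"
    using vs.span_superset V_span unfolding V_def by (rule order_trans)
  then have "card (F ` {..<k}) \<le> card (B ` S)"
    using vs.independent_span_bound[OF fin(1) indep_F] by auto
  then have "card S = k"
    using fin(2) by (simp add: card_image inj_F inj_B)
  then obtain e where e: "bij_betw e {..<k} S"
    using ex_bij_betw_nat_finite[OF fin_S] by (auto simp: lessThan_atLeast0)
  have e_S: "e l \<in> S" if "l < k" for l
    using e that by (auto simp: bij_betw_def)
  have "\<exists>u. F j = fps_combination k (\<lambda>l. B (e l)) u" if "j < k" for j
  proof -
    have "F j \<in> vs.span (B ` S)"
      using F_span that by auto
    then obtain u where "F j = (\<Sum>w\<in>B ` S. fps_const (u w) * w)"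
      by (auto simp: vs.span_finite[OF fin(1)])
    also have "\<dots> = (\<Sum>s\<in>S. fps_const (u (B s)) * B s)"
      by (subst sum.reindex[OF inj_B]) simp
    also have "\<dots> = fps_combination k (\<lambda>l. B (e l)) (\<lambda>l. u (B (e l)))"
      unfolding fps_combination_def by (rule sum.reindex_bij_betw[OF e, symmetric])
    finally show ?thesis
      by blast
  qed
  then obtain y where y: "F j = fps_combination k (\<lambda>l. B (e l)) (y j)" if "j < k" for j
    by metis
  show ?thesis
  proof (rule that[of "\<lambda>l. B (e l)" "\<lambda>l j. y j l"])
    show "B (e l) \<noteq> 0" if "l < k" for l
      using B(2) e_S[OF that] by blast
    have "bij_betw (\<lambda>l. subdegree (B (e l))) {..<k} S \<longleftrightarrow> bij_betw e {..<k} S"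
      by (rule bij_betw_cong) (use B(3) e_S in auto)
    then show "bij_betw (\<lambda>l. subdegree (B (e l))) {..<k} (span_orders k F)"
      using e by (simp add: S_def)
    show "F j = fps_combination k (\<lambda>l. B (e l)) (\<lambda>l. y j l)" if "j < k" for j
      using y[OF that] .
  qed
qed

text \<open>
  Passing to a basis with distinct orders multiplies the determinant by that of a matrix of constants,
  which is non-zero by linear independence and therefore does not change the order.
\<close>
lemma subdegree_det_theta_matrix:
  fixes F :: "nat \<Rightarrow> 'a :: field_char_0 fps"
  assumes indep: "fps_independent k F" and c: "c \<noteq> 0"
  shows "subdegree (Determinant.det (theta_matrix k c F)) = \<Sum> (span_orders k F)"
proof -
  obtain b x where b: "\<And>l. l < k \<Longrightarrow> b l \<noteq> 0"
      and bij: "bij_betw (\<lambda>l. subdegree (b l)) {..<k} (span_orders k F)"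
      and x: "\<And>j. j < k \<Longrightarrow> F j = fps_combination k b (\<lambda>l. x l j)"
    using basis_with_distinct_orders[OF indep] by blast
  define X where "X = Matrix.mat k k (\<lambda>(l, j). x l j)"
  have X: "X \<in> carrier_mat k k"
    by (simp add: X_def)
  interpret const: comm_ring_hom "fps_const :: 'a \<Rightarrow> 'a fps"
    by unfold_locales (simp_all flip: fps_const_add fps_const_mult)
  have "theta_matrix k c F = theta_matrix k c b * map_mat fps_const X"
  proof (rule eq_matI)
    fix i j
    assume "i < dim_row (theta_matrix k c b * map_mat fps_const X)"
      and "j < dim_col (theta_matrix k c b * map_mat fps_const X)"
    then have ij: "i < k" "j < k"
      by (simp_all add: theta_matrix_def X_def)
    have "(theta c ^^ i) (F j) = (\<Sum>l<k. fps_const (x l j) * (theta c ^^ i) (b l))"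
      by (simp add: x ij fps_combination_def theta_funpow_linear)
    also have "\<dots> = (\<Sum>l<k. (theta c ^^ i) (b l) * fps_const (x l j))"
      by (simp add: mult.commute)
    finally show "theta_matrix k c F $$ (i, j) = (theta_matrix k c b * map_mat fps_const X) $$ (i, j)"
      using ij by (simp add: theta_matrix_def X_def scalar_prod_def lessThan_atLeast0)
  qed (simp_all add: theta_matrix_def X_def)
  then have det_eq: "Determinant.det (theta_matrix k c F) =
      Determinant.det (theta_matrix k c b) * fps_const (Determinant.det X)"
    using X by (simp add: det_mult[of _ k])
  have "Determinant.det X \<noteq> 0"
  proof
    assume "Determinant.det X = 0"
    then obtain v where v: "v \<in> carrier_vec k" "v \<noteq> 0\<^sub>v k" "X *\<^sub>v v = 0\<^sub>v k"
      using det_0_iff_vec_prod_zero[OF X] by auto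
    have row: "(\<Sum>j<k. x l j * vec_index v j) = 0" if "l < k" for l
    proof -
      have "vec_index (X *\<^sub>v v) l = 0"
        using v(3) that by simp
      then show ?thesis
        using that v(1) by (simp add: X_def scalar_prod_def lessThan_atLeast0)
    qed
    have "fps_combination k F (vec_index v) =
        (\<Sum>j<k. \<Sum>l<k. fps_const (x l j * vec_index v j) * b l)"
      by (simp add: fps_combination_def x sum_distrib_left mult_ac flip: fps_const_mult)
    also have "\<dots> = (\<Sum>l<k. fps_const (\<Sum>j<k. x l j * vec_index v j) * b l)"
      by (subst sum.swap) (simp add: const.hom_sum sum_distrib_right)
    also have "\<dots> = 0"
      by (simp add: row)
    finally have "\<forall>j<k. vec_index v j = 0"
      using indep by (auto simp: fps_independent_def)
    with v(1,2) show False
      by (auto intro: eq_vecI)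
  qed
  moreover have "inj_on (\<lambda>l. subdegree (b l)) {..<k}"
    using bij by (rule bij_betw_imp_inj_on)
  ultimately have "subdegree (Determinant.det (theta_matrix k c F)) = (\<Sum>l<k. subdegree (b l))"
    using subdegree_det_theta_matrix_distinct[OF c b, of k] by (simp add: det_eq)
  also have "\<dots> = \<Sum> (span_orders k F)"
    using sum.reindex_bij_betw[OF bij, of "\<lambda>s. s"] by simp
  finally show ?thesis .
qed

section \<open>The width of the cusp at infinity\<close>
lemma matrix_2_eqI:
  fixes A B :: "'a ^ 2 ^ 2"
  assumes "A $ 1 $ 1 = B $ 1 $ 1" "A $ 1 $ 2 = B $ 1 $ 2" "A $ 2 $ 1 = B $ 2 $ 1" "A $ 2 $ 2 = B $ 2 $ 2"
  shows "A = B"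
  using assms by (simp add: vec_eq_iff forall_2)

lemma matrix_mult_2_nth [simp]:
  fixes A B :: "'a :: semiring_1 ^ 2 ^ 2"
  shows "(A ** B) $ i $ j = A $ i $ 1 * B $ 1 $ j + A $ i $ 2 * B $ 2 $ j"
  by (simp add: matrix_matrix_mult_def sum_2)

lemma mat_1_2_nth [simp]:
  "(Finite_Cartesian_Product.mat 1 :: real ^ 2 ^ 2) $ 1 $ 1 = 1"
  "(Finite_Cartesian_Product.mat 1 :: real ^ 2 ^ 2) $ 1 $ 2 = 0"
  "(Finite_Cartesian_Product.mat 1 :: real ^ 2 ^ 2) $ 2 $ 1 = 0"
  "(Finite_Cartesian_Product.mat 1 :: real ^ 2 ^ 2) $ 2 $ 2 = 1"
  by (simp_all add: Finite_Cartesian_Product.mat_def)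

lemma translation_nth [simp]:
  "translation t $ 1 $ 1 = 1" "translation t $ 1 $ 2 = t"
  "translation t $ 2 $ 1 = 0" "translation t $ 2 $ 2 = 1"
  by (simp_all add: translation_def)

lemma group_SL2R: "group SL2R"
proof (rule groupI)
  fix A assume A: "A \<in> carrier SL2R"
  define B :: "real ^ 2 ^ 2" where "B = vector [vector [A $ 2 $ 2, - A $ 1 $ 2], vector [- A $ 2 $ 1, A $ 1 $ 1]]"
  have "Determinants.det B = 1"
    using A by (simp add: SL2R_def det_2 B_def algebra_simps)
  moreover have "B ** A = Finite_Cartesian_Product.mat 1"
    using A by (intro matrix_2_eqI) (simp_all add: B_def SL2R_def det_2 algebra_simps)
  ultimately show "\<exists>B\<in>carrier SL2R. B \<otimes>\<^bsub>SL2R\<^esub> A = \<one>\<^bsub>SL2R\<^esub>"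
    by (auto simp: SL2R_def)
qed (auto simp: SL2R_def Determinants.det_mul matrix_mul_assoc)

lemma subgroup_SL2R_D:
  assumes "subgroup \<Gamma> SL2R"
  shows "Finite_Cartesian_Product.mat 1 \<in> \<Gamma>"
    and "A \<in> \<Gamma> \<Longrightarrow> Determinants.det A = 1"
    and "A \<in> \<Gamma> \<Longrightarrow> B \<in> \<Gamma> \<Longrightarrow> A ** B \<in> \<Gamma>"
    and "A \<in> \<Gamma> \<Longrightarrow> B ** A = Finite_Cartesian_Product.mat 1 \<Longrightarrow> B \<in> \<Gamma>"
proof -
  show "Finite_Cartesian_Product.mat 1 \<in> \<Gamma>"
    using subgroup.one_closed[OF assms] by (simp add: SL2R_def)
  show det_1: "Determinants.det A = 1" if "A \<in> \<Gamma>" for A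
    using subgroup.mem_carrier[OF assms that] by (simp add: SL2R_def)
  show "A ** B \<in> \<Gamma>" if "A \<in> \<Gamma>" "B \<in> \<Gamma>"
    using subgroup.m_closed[OF assms that] by (simp add: SL2R_def)
  show "B \<in> \<Gamma>" if A: "A \<in> \<Gamma>" and B: "B ** A = Finite_Cartesian_Product.mat 1"
  proof -
    have "Determinants.det B * Determinants.det A = 1"
      using B by (metis Determinants.det_mul Determinants.det_I)
    then have "B \<in> carrier SL2R" "A \<in> carrier SL2R"
      using det_1[OF A] by (simp_all add: SL2R_def)
    moreover have "B \<otimes>\<^bsub>SL2R\<^esub> A = \<one>\<^bsub>SL2R\<^esub>"
      using B by (simp add: SL2R_def)
    ultimately have "inv\<^bsub>SL2R\<^esub> A = B"
      using group.inv_equality[OF group_SL2R] by blast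
    then show ?thesis
      using subgroup.m_inv_closed[OF assms A] by simp
  qed
qed

text \<open>
  The generator is the least positive element. It exists because the infimum of the positive elements is
  approached within less than the gap, and two elements that close together are equal.
\<close>
lemma discrete_real_subgroup_cyclic:
  fixes T :: "real set"
  assumes diff: "\<And>s t. s \<in> T \<Longrightarrow> t \<in> T \<Longrightarrow> s - t \<in> T"
    and nontrivial: "t\<^sub>0 \<in> T" "t\<^sub>0 \<noteq> 0"
    and gap: "\<delta> > 0" "\<And>t. t \<in> T \<Longrightarrow> 0 < t \<Longrightarrow> \<delta> \<le> t"
  obtains h where "h > 0" and "T = range (\<lambda>l::int. of_int l * h)"
proof -
  have zero: "0 \<in> T"
    using diff[OF nontrivial(1) nontrivial(1)] by simp
  have uminus: "- t \<in> T" if "t \<in> T" for t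
    using diff[OF zero that] by simp
  have add: "s + t \<in> T" if "s \<in> T" "t \<in> T" for s t
    using diff[OF that(1) uminus[OF that(2)]] by simp
  have nat_mult: "of_nat n * t \<in> T" if "t \<in> T" for n t
    by (induction n) (auto simp: zero that distrib_right intro: add)
  have int_mult: "of_int l * t \<in> T" if "t \<in> T" for l :: int and t
  proof (cases l)
    case (nonneg n)
    then show ?thesis
      using nat_mult[OF that, of n] by simp
  next
    case (neg n)
    then have "real_of_int l = - of_nat (Suc n)"
      by simp
    then show ?thesis
      using uminus[OF nat_mult[OF that, of "Suc n"]] by (simp only: mult_minus_left)
  qed
  define P where "P = {t \<in> T. 0 < t}"
  have P: "P \<noteq> {}" "bdd_below P"
    using nontrivial uminus[OF nontrivial(1)] by (cases "t\<^sub>0 > 0") (auto simp: P_def intro!: bdd_belowI[of _ 0] less_imp_le)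
  obtain t where t: "t \<in> P" "t < Inf P + \<delta>"
    using cInf_lessD[OF P(1), of "Inf P + \<delta>"] gap(1) by auto
  have t_least: "t \<le> s" if "s \<in> P" for s
  proof (rule ccontr)
    assume "\<not> t \<le> s"
    then have "t - s \<in> T" "0 < t - s"
      using t(1) that diff by (auto simp: P_def)
    then have "\<delta> \<le> t - s"
      by (rule gap(2))
    then show False
      using cInf_lower[OF that P(2)] t(2) by simp
  qed
  have "s \<in> range (\<lambda>l::int. of_int l * t)" if "s \<in> T" for s
  proof -
    define r where "r = s - of_int \<lfloor>s / t\<rfloor> * t"
    have "t > 0"
      using t(1) by (simp add: P_def)
    then have "0 \<le> r" "r < t"
      using floor_divide_lower[of t s] floor_divide_upper[of t s] by (auto simp: r_def algebra_simps)
    moreover have "r \<in> T"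
      using that t(1) unfolding r_def P_def by (intro diff int_mult) auto
    ultimately have "r = 0"
      using t_least[of r] by (force simp: P_def)
    then show ?thesis
      by (auto simp: r_def)
  qed
  then show ?thesis
    using t(1) int_mult by (intro that[of t]) (auto simp: P_def)
qed

lemma translation_eq_iff [simp]:
  "translation s = translation t \<longleftrightarrow> s = t"
  "translation s \<noteq> - translation t"
  "- translation t \<noteq> translation s"
proof -
  show "translation s = translation t \<longleftrightarrow> s = t"
    by (metis translation_nth(2))
  have "translation s $ 1 $ 1 \<noteq> (- translation t) $ 1 $ 1"
    by simp
  then show "translation s \<noteq> - translation t" "- translation t \<noteq> translation s"
    by metis+
qed

text \<open>
  Both signs are admitted because \<open>- 1\<close> need not belong to \<open>\<Gamma>\<close>, while the width of the cusp is defined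
  through \<open>{\<plusminus>1} \<Gamma>\<close>.
\<close>
definition translation_lengths :: "(real ^ 2 ^ 2) set \<Rightarrow> real set" where
  "translation_lengths \<Gamma> = {t. translation t \<in> \<Gamma> \<or> - translation t \<in> \<Gamma>}"

lemma translation_lengths_diff:
  assumes \<Gamma>: "subgroup \<Gamma> SL2R" and "s \<in> translation_lengths \<Gamma>" "t \<in> translation_lengths \<Gamma>"
  shows "s - t \<in> translation_lengths \<Gamma>"
proof -
  \<comment> \<open>Writing the signs as scalars treats the four combinations at once.\<close>
  obtain a b :: real where a: "a = 1 \<or> a = -1" "a *\<^sub>R translation s \<in> \<Gamma>"
      and b: "b = 1 \<or> b = -1" "b *\<^sub>R translation t \<in> \<Gamma>"
    using assms(2,3) unfolding translation_lengths_def
    by (metis (mono_tags, lifting) mem_Collect_eq scaleR_minus1_left scaleR_one)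
  have "b *\<^sub>R translation (- t) ** (b *\<^sub>R translation t) = Finite_Cartesian_Product.mat 1"
    using b(1) by (intro matrix_2_eqI) auto
  then have "b *\<^sub>R translation (- t) \<in> \<Gamma>"
    using subgroup_SL2R_D(4)[OF \<Gamma> b(2)] by blast
  then have "a *\<^sub>R translation s ** (b *\<^sub>R translation (- t)) \<in> \<Gamma>"
    using subgroup_SL2R_D(3)[OF \<Gamma> a(2)] by blast
  also have "a *\<^sub>R translation s ** (b *\<^sub>R translation (- t)) = (a * b) *\<^sub>R translation (s - t)"
    by (intro matrix_2_eqI) (simp_all add: algebra_simps)
  finally show ?thesis
    using a(1) b(1) by (auto simp: translation_lengths_def)
qed

text \<open>
  A short translation has a short square, and the square lies in \<open>\<Gamma>\<close> whichever sign occurs, so it would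
  contradict the isolation of the identity.
\<close>
lemma translation_lengths_gap:
  assumes \<Gamma>: "subgroup \<Gamma> SL2R" and disc: "discrete \<Gamma>"
  obtains \<delta> where "\<delta> > 0" "\<And>t. t \<in> translation_lengths \<Gamma> \<Longrightarrow> 0 < t \<Longrightarrow> \<delta> \<le> t"
proof -
  obtain e where e: "e > 0" "\<And>A. A \<in> \<Gamma> \<Longrightarrow> dist (Finite_Cartesian_Product.mat 1) A < e \<Longrightarrow> A = Finite_Cartesian_Product.mat 1"
    using disc subgroup_SL2R_D(1)[OF \<Gamma>] unfolding discrete_def isolated_in_dist_Ex_iff by blast
  have dist: "dist (Finite_Cartesian_Product.mat 1) (translation t) = \<bar>t\<bar>" for t
    by (simp add: dist_norm norm_vec_def L2_set_def sum_2)
  have "e / 2 \<le> t" if t: "t \<in> translation_lengths \<Gamma>" "0 < t" for t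
  proof (rule ccontr)
    assume "\<not> e / 2 \<le> t"
    then have "dist (Finite_Cartesian_Product.mat 1) (translation (2 * t)) < e"
      using t(2) by (simp add: dist)
    moreover have "translation (2 * t) = translation t ** translation t"
      "translation (2 * t) = (- translation t) ** (- translation t)"
      by (intro matrix_2_eqI; simp)+
    then have "translation (2 * t) \<in> \<Gamma>"
      using t(1) subgroup_SL2R_D(3)[OF \<Gamma>] unfolding translation_lengths_def
      by (metis (no_types, lifting) mem_Collect_eq)
    ultimately have "translation (2 * t) = Finite_Cartesian_Product.mat 1"
      using e(2) by blast
    then have "2 * t = 0"
      by (metis translation_nth(2) mat_1_2_nth(2))
    with t(2) show False
      by simp
  qed
  then show ?thesis
    using that[of "e / 2"] e(1) by simp
qed

lemma moebius_boundary_Infinity_fixed_iff: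
  "moebius_boundary g Infinity = Infinity \<longleftrightarrow> g $ 2 $ 1 = 0"
  by simp

text \<open>
  An element of the stabilizer of \<open>\<infinity>\<close> acts on the translations by conjugation; its two diagonal entries
  \<open>a\<close> and \<open>d\<close> are inverse to each other, so \<open>a\<^sup>2\<close> and \<open>d\<^sup>2\<close> are the scaling factors of conjugation by the
  element and by its inverse.
\<close>
lemma stabilizer_scales_translation_lengths:
  assumes \<Gamma>: "subgroup \<Gamma> SL2R" and g: "g \<in> \<Gamma>" "g $ 2 $ 1 = 0" and t: "t \<in> translation_lengths \<Gamma>"
  shows "(g $ 1 $ 1)\<^sup>2 * t \<in> translation_lengths \<Gamma>" "(g $ 2 $ 2)\<^sup>2 * t \<in> translation_lengths \<Gamma>"
proof -
  define g' :: "real ^ 2 ^ 2" where "g' = vector [vector [g $ 2 $ 2, - g $ 1 $ 2], vector [0, g $ 1 $ 1]]"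
  have det: "g $ 1 $ 1 * g $ 2 $ 2 = 1"
    using subgroup_SL2R_D(2)[OF \<Gamma> g(1)] g(2) by (simp add: det_2)
  then have det': "g $ 2 $ 2 * g $ 1 $ 1 = 1"
    by (simp add: mult.commute)
  have "g' ** g = Finite_Cartesian_Product.mat 1"
    by (intro matrix_2_eqI) (simp_all add: g'_def g(2) det det')
  then have g': "g' \<in> \<Gamma>"
    using subgroup_SL2R_D(4)[OF \<Gamma> g(1)] by blast
  have conj: "g ** translation t ** g' = translation ((g $ 1 $ 1)\<^sup>2 * t)"
    "g ** (- translation t) ** g' = - translation ((g $ 1 $ 1)\<^sup>2 * t)"
    "g' ** translation t ** g = translation ((g $ 2 $ 2)\<^sup>2 * t)"
    "g' ** (- translation t) ** g = - translation ((g $ 2 $ 2)\<^sup>2 * t)"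
    by (intro matrix_2_eqI; simp add: g'_def g(2) det det' power2_eq_square algebra_simps)+
  note mult = subgroup_SL2R_D(3)[OF \<Gamma>]
  have pm: "translation t \<in> \<Gamma> \<or> - translation t \<in> \<Gamma>"
    using t by (simp add: translation_lengths_def)
  have "g ** translation t ** g' \<in> \<Gamma> \<or> g ** (- translation t) ** g' \<in> \<Gamma>"
    using pm by (elim disj_forward) (erule mult[OF mult[OF g(1)] g'])+
  then show "(g $ 1 $ 1)\<^sup>2 * t \<in> translation_lengths \<Gamma>"
    by (simp only: conj translation_lengths_def mem_Collect_eq)
  have "g' ** translation t ** g \<in> \<Gamma> \<or> g' ** (- translation t) ** g \<in> \<Gamma>"
    using pm by (elim disj_forward) (erule mult[OF mult[OF g'] g(1)])+
  then show "(g $ 2 $ 2)\<^sup>2 * t \<in> translation_lengths \<Gamma>"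
    by (simp only: conj translation_lengths_def mem_Collect_eq)
qed

text \<open>
  The translation lengths form a discrete group, which a parabolic element fixing \<open>\<infinity>\<close> makes non-trivial, so
  they are the multiples of some \<open>h > 0\<close>. An element of the stabilizer of \<open>\<infinity>\<close> with diagonal \<open>a, d\<close> scales
  this lattice into itself by \<open>a\<^sup>2\<close> and by \<open>d\<^sup>2\<close>. These are then integers with product \<open>1\<close>, hence both
  equal to \<open>1\<close>, and the element is a translation up to sign. So \<open>h\<close> has the property that defines the
  width, and it is the only positive number that has it.
\<close>
lemma cusp_width_pos:
  assumes \<Gamma>: "subgroup \<Gamma> SL2R" and disc: "discrete \<Gamma>" and cusp: "is_cusp \<Gamma> Infinity"
  shows "cusp_width \<Gamma> > 0"
proof -
  have unit_diag: "\<exists>t. g = translation t \<or> g = - translation t"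
    if "g $ 2 $ 1 = 0" "g $ 1 $ 1 * g $ 2 $ 2 = 1" "(g $ 1 $ 1)\<^sup>2 = 1" for g :: "real ^ 2 ^ 2"
  proof (cases "g $ 1 $ 1 = 1")
    case True
    then have "g = translation (g $ 1 $ 2)"
      using that by (intro matrix_2_eqI) auto
    then show ?thesis
      by blast
  next
    case False
    then have "g $ 1 $ 1 = -1"
      using that(3) by (simp add: power2_eq_1_iff)
    then have "g = - translation (- g $ 1 $ 2)"
      using that by (intro matrix_2_eqI) auto
    then show ?thesis
      by blast
  qed
  obtain p where p: "p \<in> \<Gamma>" "parabolic p" "p $ 2 $ 1 = 0"
    using cusp unfolding is_cusp_def moebius_boundary_Infinity_fixed_iff by blast
  have det_p: "p $ 1 $ 1 * p $ 2 $ 2 = 1"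
    using p(2,3) by (simp add: parabolic_def det_2)
  have "\<bar>p $ 1 $ 1 + p $ 2 $ 2\<bar> = 2"
    using p(2) by (simp add: parabolic_def trace_def sum_2)
  then have "(p $ 1 $ 1 + p $ 2 $ 2)\<^sup>2 = 2\<^sup>2"
    by (metis power2_abs)
  \<comment> \<open>\<open>(a - d)\<^sup>2 = (a + d)\<^sup>2 - 4 a d\<close> vanishes for a parabolic element.\<close>
  then have "(p $ 1 $ 1 - p $ 2 $ 2)\<^sup>2 = 0"
    using det_p by (simp add: power2_eq_square algebra_simps)
  then have "(p $ 1 $ 1)\<^sup>2 = 1"
    using det_p by (simp add: power2_eq_square)
  then obtain t\<^sub>0 where t\<^sub>0: "p = translation t\<^sub>0 \<or> p = - translation t\<^sub>0"
    using unit_diag[OF p(3) det_p] by blast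
  have "translation 0 = Finite_Cartesian_Product.mat 1"
    by (intro matrix_2_eqI) simp_all
  then have "t\<^sub>0 \<noteq> 0"
    using t\<^sub>0 p(2) by (auto simp: parabolic_def)
  moreover have "t\<^sub>0 \<in> translation_lengths \<Gamma>"
    using t\<^sub>0 p(1) by (auto simp: translation_lengths_def)
  moreover obtain \<delta> where "\<delta> > 0" "\<And>t. t \<in> translation_lengths \<Gamma> \<Longrightarrow> 0 < t \<Longrightarrow> \<delta> \<le> t"
    using translation_lengths_gap[OF \<Gamma> disc] by blast
  ultimately obtain h where h: "h > 0" and lengths: "translation_lengths \<Gamma> = range (\<lambda>l::int. of_int l * h)"
    using discrete_real_subgroup_cyclic[OF translation_lengths_diff[OF \<Gamma>]] by metis

  have stab: "\<exists>l::int. g = translation (of_int l * h) \<or> g = - translation (of_int l * h)"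
    if g: "g \<in> \<Gamma>" "g $ 2 $ 1 = 0" for g
  proof -
    have det: "g $ 1 $ 1 * g $ 2 $ 2 = 1"
      using subgroup_SL2R_D(2)[OF \<Gamma> g(1)] g(2) by (simp add: det_2)
    have "h \<in> translation_lengths \<Gamma>"
      unfolding lengths by (auto intro: range_eqI[of _ _ 1])
    from stabilizer_scales_translation_lengths[OF \<Gamma> g this]
    obtain a d :: int where ad: "(g $ 1 $ 1)\<^sup>2 = of_int a" "(g $ 2 $ 2)\<^sup>2 = of_int d"
      using h unfolding lengths by auto
    have "real_of_int (a * d) = (g $ 1 $ 1 * g $ 2 $ 2)\<^sup>2"
      by (simp add: ad power_mult_distrib)
    then have "a * d = 1"
      unfolding det by (simp only: one_power2 of_int_eq_1_iff)
    moreover have "a \<ge> 0"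
      using zero_le_power2[of "g $ 1 $ 1"] unfolding ad by simp
    ultimately have "a = 1"
      using zmult_eq_1_iff by fastforce
    then obtain t where t: "g = translation t \<or> g = - translation t"
      using unit_diag[OF g(2) det] ad by auto
    then have "t \<in> translation_lengths \<Gamma>"
      using g(1) by (auto simp: translation_lengths_def)
    then show ?thesis
      using t unfolding lengths by auto
  qed
  define stabilizer where
    "stabilizer = {g. \<exists>\<gamma>\<in>\<Gamma>. moebius_boundary \<gamma> Infinity = Infinity \<and> (g = \<gamma> \<or> g = - \<gamma>)}"
  define translation_group where
    "translation_group h = {g. \<exists>l::int. g = translation (of_int l * h) \<or> g = - translation (of_int l * h)}" for h
  have "stabilizer = translation_group h"
  proof (intro equalityI subsetI)
    fix g assume "g \<in> stabilizer"
    then obtain \<gamma> where \<gamma>: "\<gamma> \<in> \<Gamma>" "\<gamma> $ 2 $ 1 = 0" "g = \<gamma> \<or> g = - \<gamma>"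
      unfolding stabilizer_def moebius_boundary_Infinity_fixed_iff by blast
    then show "g \<in> translation_group h"
      using stab[OF \<gamma>(1,2)] unfolding translation_group_def by auto
  next
    fix g assume "g \<in> translation_group h"
    then obtain l :: int where l: "g = translation (of_int l * h) \<or> g = - translation (of_int l * h)"
      by (auto simp: translation_group_def)
    have "of_int l * h \<in> translation_lengths \<Gamma>"
      unfolding lengths by blast
    then obtain \<gamma> where \<gamma>: "\<gamma> \<in> \<Gamma>" "\<gamma> = translation (of_int l * h) \<or> \<gamma> = - translation (of_int l * h)"
      by (auto simp: translation_lengths_def)
    have "\<gamma> $ 2 $ 1 = 0" "g = \<gamma> \<or> g = - \<gamma>"
      using \<gamma>(2) l by auto
    then show "g \<in> stabilizer"
      using \<gamma>(1) unfolding stabilizer_def moebius_boundary_Infinity_fixed_iff by blast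
  qed
  moreover have "h' = h" if h': "h' > 0" and eq: "translation_group h = translation_group h'" for h'
  proof -
    have mult: "\<exists>l::int. s = of_int l * t" if "translation_group s = translation_group t" for s t
    proof -
      have "translation s \<in> translation_group s"
        unfolding translation_group_def mem_Collect_eq by (rule exI[of _ 1]) simp
      then show ?thesis
        unfolding that by (auto simp: translation_group_def)
    qed
    obtain l l' :: int where l: "h = of_int l * h'" "h' = of_int l' * h"
      using mult[OF eq] mult[OF eq[symmetric]] by blast
    then have "h = of_int (l * l') * h"
      by simp
    then have "l * l' = 1"
      using h by (metis mult_cancel_right1 of_int_eq_1_iff less_irrefl)
    moreover have "l > 0"
      using l(1) h h' by (metis of_int_0_less_iff zero_less_mult_pos2)
    ultimately have "l = 1"
      using zmult_eq_1_iff by fastforce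
    then show ?thesis
      using l(1) by simp
  qed
  ultimately have "cusp_width \<Gamma> = h"
    unfolding cusp_width_def stabilizer_def[symmetric] translation_group_def[symmetric]
    using h by (intro the_equality) auto
  with h show ?thesis
    by simp
qed

section \<open>Calculus of q-expansions\<close>
lemma conjugate_group_one: "conjugate_group (Finite_Cartesian_Product.mat 1) \<Gamma> = \<Gamma>"
proof -
  have "matrix_inv (Finite_Cartesian_Product.mat 1 :: real ^ 2 ^ 2) = Finite_Cartesian_Product.mat 1"
    unfolding matrix_inv_def by (rule some_equality) auto
  then show ?thesis
    by (simp add: conjugate_group_def)
qed

lemma slash_one: "slash m f (Finite_Cartesian_Product.mat 1) = f"
  by (rule ext) (simp add: slash_def moebius_def aut_factor_def)

text \<open>
  Holomorphy at all cusps is applied with \<open>\<sigma> = 1\<close>, which carries \<open>\<infinity>\<close> to itself.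
\<close>
lemma modular_form_has_q_expansion:
  assumes "f \<in> modular_forms \<Gamma> m" "is_cusp \<Gamma> Infinity"
  shows "\<exists>A. has_q_expansion (cusp_width \<Gamma>) f A"
proof -
  have "Finite_Cartesian_Product.mat 1 \<in> carrier SL2R"
    by (simp add: SL2R_def)
  moreover have "is_cusp \<Gamma> (moebius_boundary (Finite_Cartesian_Product.mat 1) Infinity)"
    using assms(2) by simp
  ultimately have "\<exists>A. has_q_expansion (cusp_width (conjugate_group (Finite_Cartesian_Product.mat 1) \<Gamma>))
      (slash m f (Finite_Cartesian_Product.mat 1)) A"
    using assms(1) unfolding modular_forms_def by blast
  then show ?thesis
    by (simp only: conjugate_group_one slash_one)
qed

definition cusp_parameter :: "real \<Rightarrow> complex \<Rightarrow> complex" where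
  "cusp_parameter h z = exp (2 * of_real pi * \<i> * z / of_real h)"

lemma norm_cusp_parameter: "norm (cusp_parameter h z) = exp (- 2 * pi * Im z / h)"
  by (simp add: cusp_parameter_def norm_exp_eq_Re)

lemma norm_cusp_parameter_less_1:
  assumes "h > 0" "z \<in> upper_half_plane"
  shows "norm (cusp_parameter h z) < 1"
  using assms by (simp add: norm_cusp_parameter upper_half_plane_def)

lemma cusp_parameter_surj:
  assumes "h > 0" "q \<noteq> 0" "norm q < 1"
  obtains z where "z \<in> upper_half_plane" "cusp_parameter h z = q"
proof
  define z where "z = of_real h * Ln q / (2 * of_real pi * \<i>)"
  have "Im z = - (h * ln (norm q) / (2 * pi))"
    using assms(2) by (simp add: z_def Im_divide power2_eq_square)
  then show "z \<in> upper_half_plane"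
    using assms by (simp add: upper_half_plane_def mult_pos_neg divide_neg_pos)
  show "cusp_parameter h z = q"
    using assms by (simp add: cusp_parameter_def z_def)
qed

text \<open>
  As \<open>z\<close> runs through the upper half-plane, \<open>q\<close> runs through the punctured unit disc, so convergence of
  the expansion for all \<open>z\<close> means radius of convergence at least \<open>1\<close>. This form makes the calculus of
  convergent power series available for \<open>q\<close>-expansions.
\<close>
lemma has_q_expansion_iff:
  assumes "h > 0"
  shows "has_q_expansion h f A \<longleftrightarrow>
    fps_conv_radius A \<ge> 1 \<and> (\<forall>z\<in>upper_half_plane. f z = eval_fps A (cusp_parameter h z))"
proof
  assume q: "has_q_expansion h f A"
  then have sums: "(\<lambda>n. fps_nth A n * cusp_parameter h z ^ n) sums f z" if "z \<in> upper_half_plane" for z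
    using that by (simp add: has_q_expansion_def cusp_parameter_def)
  have "fps_conv_radius A \<ge> 1"
    unfolding fps_conv_radius_def
  proof (rule conv_radius_geI_ex')
    fix r :: real assume r: "0 < r" "ereal r < 1"
    then obtain z where "z \<in> upper_half_plane" "cusp_parameter h z = of_real r"
      using cusp_parameter_surj[OF assms, of "of_real r"] by auto
    then show "summable (\<lambda>n. fps_nth A n * of_real r ^ n)"
      using sums[of z] by (auto intro: sums_summable)
  qed
  moreover have "f z = eval_fps A (cusp_parameter h z)" if "z \<in> upper_half_plane" for z
    using sums[OF that] by (simp add: eval_fps_def sums_iff)
  ultimately show "fps_conv_radius A \<ge> 1 \<and> (\<forall>z\<in>upper_half_plane. f z = eval_fps A (cusp_parameter h z))"
    by blast
next
  assume R: "fps_conv_radius A \<ge> 1 \<and> (\<forall>z\<in>upper_half_plane. f z = eval_fps A (cusp_parameter h z))"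
  have "(\<lambda>n. fps_nth A n * cusp_parameter h z ^ n) sums f z" if "z \<in> upper_half_plane" for z
  proof -
    have "ereal (norm (cusp_parameter h z)) < 1"
      using norm_cusp_parameter_less_1[OF assms that] by simp
    also have "\<dots> \<le> fps_conv_radius A"
      using R by blast
    finally show ?thesis
      using sums_eval_fps[of "cusp_parameter h z" A] R that by simp
  qed
  then show "has_q_expansion h f A"
    by (simp add: has_q_expansion_def cusp_parameter_def)
qed

lemma has_q_expansion_in_disc:
  assumes "h > 0" "has_q_expansion h f A" "z \<in> upper_half_plane"
  shows "ereal (norm (cusp_parameter h z)) < fps_conv_radius A"
proof -
  have "ereal (norm (cusp_parameter h z)) < 1"
    using norm_cusp_parameter_less_1[OF assms(1,3)] by simp
  also have "\<dots> \<le> fps_conv_radius A"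
    using assms(1,2) by (simp add: has_q_expansion_iff)
  finally show ?thesis .
qed

lemma has_q_expansion_const:
  assumes "h > 0"
  shows "has_q_expansion h (\<lambda>z. c) (fps_const c)"
  using assms by (simp add: has_q_expansion_iff)

lemma has_q_expansion_add:
  assumes "h > 0" "has_q_expansion h f A" "has_q_expansion h g B"
  shows "has_q_expansion h (\<lambda>z. f z + g z) (A + B)"
proof -
  have "fps_conv_radius (A + B) \<ge> 1"
    using assms fps_conv_radius_add[of A B] by (auto simp: has_q_expansion_iff intro: order_trans[rotated])
  then show ?thesis
    using assms has_q_expansion_in_disc[OF assms(1,2)] has_q_expansion_in_disc[OF assms(1,3)]
    by (simp add: has_q_expansion_iff eval_fps_add)
qed

lemma has_q_expansion_mult:
  assumes "h > 0" "has_q_expansion h f A" "has_q_expansion h g B"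
  shows "has_q_expansion h (\<lambda>z. f z * g z) (A * B)"
proof -
  have "fps_conv_radius (A * B) \<ge> 1"
    using assms fps_conv_radius_mult[of A B] by (auto simp: has_q_expansion_iff intro: order_trans[rotated])
  then show ?thesis
    using assms has_q_expansion_in_disc[OF assms(1,2)] has_q_expansion_in_disc[OF assms(1,3)]
    by (simp add: has_q_expansion_iff eval_fps_mult)
qed

lemma has_q_expansion_sum:
  assumes "h > 0" "\<And>i. i \<in> I \<Longrightarrow> has_q_expansion h (f i) (A i)"
  shows "has_q_expansion h (\<lambda>z. \<Sum>i\<in>I. f i z) (\<Sum>i\<in>I. A i)"
  using assms(2)
proof (induction I rule: infinite_finite_induct)
  case (insert i I)
  then show ?case
    by (simp add: has_q_expansion_add[OF assms(1)])
qed (use has_q_expansion_const[OF assms(1), of 0] in simp_all)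

lemma has_q_expansion_prod:
  assumes "h > 0" "\<And>i. i \<in> I \<Longrightarrow> has_q_expansion h (f i) (A i)"
  shows "has_q_expansion h (\<lambda>z. \<Prod>i\<in>I. f i z) (\<Prod>i\<in>I. A i)"
  using assms(2)
proof (induction I rule: infinite_finite_induct)
  case (insert i I)
  then show ?case
    by (simp add: has_q_expansion_mult[OF assms(1)])
qed (use has_q_expansion_const[OF assms(1), of 1] in simp_all)

lemma has_q_expansion_combination:
  assumes "h > 0" "\<And>j. j < k \<Longrightarrow> has_q_expansion h (f j) (A j)"
  shows "has_q_expansion h (\<lambda>z. \<Sum>j<k. x j * f j z) (fps_combination k A x)"
  unfolding fps_combination_def
  by (intro has_q_expansion_sum has_q_expansion_mult has_q_expansion_const assms) auto

lemma has_q_expansion_deriv: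
  assumes "h > 0" "has_q_expansion h f A"
  shows "has_q_expansion h (deriv f) (theta (2 * of_real pi * \<i> / of_real h) A)"
proof -
  define c :: complex where "c = 2 * of_real pi * \<i> / of_real h"
  have R: "fps_conv_radius A \<ge> 1" and f: "\<And>z. z \<in> upper_half_plane \<Longrightarrow> f z = eval_fps A (cusp_parameter h z)"
    using assms by (auto simp: has_q_expansion_iff)
  have R': "fps_conv_radius (fps_deriv A) \<ge> 1"
    using R fps_conv_radius_deriv[of A] by (rule order_trans)
  have R'': "fps_conv_radius (fps_const c * fps_X) \<ge> 1"
    using fps_conv_radius_mult[of "fps_const c" fps_X] by (auto intro: order_trans[rotated])
  have "fps_conv_radius (theta c A) \<ge> 1"
    using R' R'' fps_conv_radius_mult[of "fps_const c * fps_X" "fps_deriv A"]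
    by (auto simp: theta_def intro: order_trans[rotated])
  moreover have "deriv f z = eval_fps (theta c A) (cusp_parameter h z)" if z: "z \<in> upper_half_plane" for z
  proof -
    let ?q = "cusp_parameter h z"
    have q1: "ereal (norm ?q) < 1"
      using norm_cusp_parameter_less_1[OF assms(1) z] by simp
    have "((\<lambda>z. exp (c * z)) has_field_derivative c * exp (c * z)) (at z)"
      by (auto intro!: derivative_eq_intros)
    then have "(cusp_parameter h has_field_derivative c * ?q) (at z)"
      by (simp add: c_def cusp_parameter_def[abs_def])
    moreover have "(eval_fps A has_field_derivative eval_fps (fps_deriv A) ?q) (at ?q)"
      using q1 R by (intro has_field_derivative_eval_fps) (rule less_le_trans)
    ultimately have "((\<lambda>w. eval_fps A (cusp_parameter h w)) has_field_derivative
        eval_fps (fps_deriv A) ?q * (c * ?q)) (at z)"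
      by (rule DERIV_chain2[rotated])
    moreover have "open upper_half_plane"
      unfolding upper_half_plane_def by (rule open_halfspace_Im_gt)
    ultimately have "(f has_field_derivative eval_fps (fps_deriv A) ?q * (c * ?q)) (at z)"
      using z f by (auto elim!: has_field_derivative_transform_within_open)
    moreover have "eval_fps (theta c A) ?q = eval_fps (fps_deriv A) ?q * (c * ?q)"
      using less_le_trans[OF q1 R'] less_le_trans[OF q1 R''] by (simp add: theta_def eval_fps_mult)
    ultimately show ?thesis
      by (simp add: DERIV_imp_deriv)
  qed
  ultimately show ?thesis
    using assms(1) by (simp add: has_q_expansion_iff c_def)
qed

lemma has_q_expansion_higher_deriv:
  assumes "h > 0" "has_q_expansion h f A"
  shows "has_q_expansion h ((deriv ^^ i) f) ((theta (2 * of_real pi * \<i> / of_real h) ^^ i) A)"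
  by (induction i) (simp_all add: assms has_q_expansion_deriv)

text \<open>
  By the Leibniz formula a determinant is built from its entries by sums and products, with which
  \<open>q\<close>-expansions commute.
\<close>
lemma has_q_expansion_wronskian:
  assumes h: "h > 0" and A: "\<And>j. j < k \<Longrightarrow> has_q_expansion h (f j) (A j)"
  shows "has_q_expansion h (wronskian k f)
    (Determinant.det (theta_matrix k (2 * of_real pi * \<i> / of_real h) A))"
proof -
  define c :: complex where "c = 2 * of_real pi * \<i> / of_real h"
  have permuted: "p i < k" if "p permutes {0..<k}" "i \<in> {0..<k}" for p i
    using permutes_in_image[OF that(1)] that(2) by auto
  have "has_q_expansion h
      (\<lambda>z. \<Sum>p | p permutes {0..<k}. of_int (sign p) * (\<Prod>i = 0..<k. (deriv ^^ i) (f (p i)) z))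
      (\<Sum>p | p permutes {0..<k}. fps_const (of_int (sign p)) * (\<Prod>i = 0..<k. (theta c ^^ i) (A (p i))))"
    unfolding c_def
    by (intro has_q_expansion_sum has_q_expansion_mult has_q_expansion_const has_q_expansion_prod
        has_q_expansion_higher_deriv h A) (auto intro: permuted)
  also have "(\<lambda>z. \<Sum>p | p permutes {0..<k}. of_int (sign p) * (\<Prod>i = 0..<k. (deriv ^^ i) (f (p i)) z)) =
      wronskian k f"
    by (auto simp: fun_eq_iff wronskian_def det_def'[of _ k] permuted intro!: sum.cong prod.cong)
  also have "(\<Sum>p | p permutes {0..<k}. fps_const (of_int (sign p)) * (\<Prod>i = 0..<k. (theta c ^^ i) (A (p i)))) =
      Determinant.det (theta_matrix k c A)"
    by (auto simp: theta_matrix_def det_def'[of _ k] permuted fps_of_int intro!: sum.cong prod.cong)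
  finally show ?thesis
    by (simp add: c_def)
qed

text \<open>
  Two expansions of \<open>f\<close> agree on the punctured disc, hence at the centre by continuity.
\<close>
lemma has_q_expansion_unique:
  assumes h: "h > 0" and "has_q_expansion h f A" "has_q_expansion h f B"
  shows "A = B"
proof (rule eval_fps_eqD)
  have R: "fps_conv_radius A \<ge> 1" "fps_conv_radius B \<ge> 1"
    using assms by (auto simp: has_q_expansion_iff)
  then show pos: "fps_conv_radius A > 0" "fps_conv_radius B > 0"
    by (auto intro: less_le_trans[of 0 1])
  have eq: "eval_fps A q = eval_fps B q" if "q \<noteq> 0" "norm q < 1" for q
  proof -
    obtain z where "z \<in> upper_half_plane" "cusp_parameter h z = q"
      using cusp_parameter_surj[OF h \<open>q \<noteq> 0\<close> \<open>norm q < 1\<close>] .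
    then show ?thesis
      using assms by (auto simp: has_q_expansion_iff)
  qed
  have "eval_fps A 0 = eval_fps B 0"
  proof (rule tendsto_unique)
    have lim: "(eval_fps F \<longlongrightarrow> eval_fps F 0) (at 0)" if "fps_conv_radius F > 0" for F :: "complex fps"
      using that by (auto intro!: isContD continuous_eval_fps simp: zero_ereal_def)
    show "(eval_fps A \<longlongrightarrow> eval_fps A 0) (at 0)"
      by (rule lim[OF pos(1)])
    have "eventually (\<lambda>q. eval_fps A q = eval_fps B q) (at (0 :: complex))"
      unfolding eventually_at using eq by (intro exI[of _ 1]) auto
    then show "(eval_fps A \<longlongrightarrow> eval_fps B 0) (at 0)"
      using lim[OF pos(2)] by (simp add: tendsto_cong)
  qed simp
  then have "eval_fps A q = eval_fps B q" if "norm q < 1" for q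
    using eq that by (cases "q = 0") auto
  then show "eventually (\<lambda>q. eval_fps A q = eval_fps B q) (nhds 0)"
    unfolding eventually_nhds_metric by (intro exI[of _ 1]) auto
qed

lemma q_expansion_eqI:
  assumes "h > 0" "has_q_expansion h f A"
  shows "q_expansion h f = A"
  unfolding q_expansion_def
proof (rule the_equality)
  show "B = A" if "has_q_expansion h f B" for B
    using has_q_expansion_unique[OF assms(1) that assms(2)] .
qed (rule assms(2))

section \<open>Orders at the cusp\<close>
lemma fps_independent_q_expansions:
  assumes h: "h > 0" and A: "\<And>j. j < k \<Longrightarrow> has_q_expansion h (f j) (A j)"
    and indep: "linearly_independent_on upper_half_plane k f"
  shows "fps_independent k A"
  unfolding fps_independent_def
proof (intro allI impI)
  fix x j assume "fps_combination k A x = 0" and j: "j < k"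
  then have "has_q_expansion h (\<lambda>z. \<Sum>j<k. x j * f j z) 0"
    using has_q_expansion_combination[of h k f A x, OF h A] by simp
  then have "\<forall>z\<in>upper_half_plane. (\<Sum>j<k. x j * f j z) = 0"
    using h by (simp add: has_q_expansion_iff)
  then show "x j = 0"
    using indep j by (simp add: linearly_independent_on_def)
qed

text \<open>
  A germ is zero exactly when its power series is, since a germ has only one power series.
\<close>
lemma frequently_nonzero_iff_fps_nonzero:
  fixes \<psi> :: "complex \<Rightarrow> complex"
  assumes "\<psi> has_fps_expansion G"
  shows "(\<exists>\<^sub>F q in nhds 0. \<psi> q \<noteq> 0) \<longleftrightarrow> G \<noteq> 0"
proof -
  have "eventually (\<lambda>q. \<psi> q = 0) (nhds 0) \<longleftrightarrow> \<psi> has_fps_expansion 0"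
    by (simp add: has_fps_expansion_def eq_commute[of 0])
  also have "\<dots> \<longleftrightarrow> G = 0"
    using assms fps_expansion_unique_complex by blast
  finally show ?thesis
    by (simp add: frequently_def)
qed

lemma order_sum_at_0_eq:
  fixes A :: "nat \<Rightarrow> complex fps"
  assumes A: "\<And>j. j < k \<Longrightarrow> fps_conv_radius (A j) > 0"
  shows "order_sum_at_0 k (\<lambda>j. eval_fps (A j)) = int (\<Sum> (span_orders k A))"
proof -
  have expansion: "(\<lambda>q. \<Sum>j<k. x j * eval_fps (A j) q) has_fps_expansion fps_combination k A x" for x
    unfolding fps_combination_def
    by (intro fps_expansion_intros eval_fps_has_fps_expansion A) auto
  have "{zorder \<psi> 0 | \<psi>. \<psi> \<in> complex_span k (\<lambda>j. eval_fps (A j)) \<and> (\<exists>\<^sub>F q in nhds 0. \<psi> q \<noteq> 0)} =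
      {zorder (\<lambda>q. \<Sum>j<k. x j * eval_fps (A j) q) 0 | x. fps_combination k A x \<noteq> 0}"
    by (auto simp: complex_span_def frequently_nonzero_iff_fps_nonzero[OF expansion])
  also have "\<dots> = {int (subdegree (fps_combination k A x)) | x. fps_combination k A x \<noteq> 0}"
    using has_fps_expansion_zorder_0[OF expansion] by (intro Collect_cong ex_cong1) auto
  also have "\<dots> = int ` span_orders k A"
    by (auto simp: span_orders_def)
  finally have orders: "{zorder \<psi> 0 | \<psi>. \<psi> \<in> complex_span k (\<lambda>j. eval_fps (A j)) \<and>
      (\<exists>\<^sub>F q in nhds 0. \<psi> q \<noteq> 0)} = int ` span_orders k A" .
  show ?thesis
    unfolding order_sum_at_0_def orders by (simp add: sum.reindex)
qed

theorem theorem7p3: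
  fixes \<Gamma> :: "(real ^ 2 ^ 2) set" and m k :: nat and f :: "nat \<Rightarrow> complex \<Rightarrow> complex"
  assumes "fuchsian_first_kind \<Gamma>"
    and "m \<ge> 2" and "even m"
    and "is_cusp \<Gamma> Infinity"
    and "k \<ge> 1"
    and "\<forall>j<k. f j \<in> modular_forms \<Gamma> m"
    and "linearly_independent_on upper_half_plane k f"
  shows "int (order_at_infinity \<Gamma> (wronskian k f)) =
    order_sum_at_0 k (\<lambda>j. as_function_of_q (cusp_width \<Gamma>) (f j))"
proof -
  define h where "h = cusp_width \<Gamma>"
  define c :: complex where "c = 2 * of_real pi * \<i> / of_real h"
  define A where "A j = q_expansion h (f j)" for j
  have h: "h > 0"
  proof -
    have "subgroup \<Gamma> SL2R" "discrete \<Gamma>"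
      using assms(1) unfolding fuchsian_first_kind_def by blast+
    then show ?thesis
      unfolding h_def using assms(4) by (rule cusp_width_pos)
  qed
  have A: "has_q_expansion h (f j) (A j)" if j: "j < k" for j
  proof -
    obtain B where "has_q_expansion h (f j) B"
      using modular_form_has_q_expansion[OF assms(6)[rule_format, OF j] assms(4)] unfolding h_def ..
    then show ?thesis
      unfolding A_def using q_expansion_eqI[OF h] by simp
  qed
  have "q_expansion h (wronskian k f) = Determinant.det (theta_matrix k c A)"
    unfolding c_def by (rule q_expansion_eqI[OF h has_q_expansion_wronskian[OF h A]])
  then have "order_at_infinity \<Gamma> (wronskian k f) = subdegree (Determinant.det (theta_matrix k c A))"
    by (simp add: order_at_infinity_def h_def)
  also have "\<dots> = \<Sum> (span_orders k A)"
  proof (rule subdegree_det_theta_matrix)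
    show "fps_independent k A"
      using fps_independent_q_expansions[OF h A assms(7)] .
    show "c \<noteq> 0"
      using h by (simp add: c_def)
  qed
  also have "int \<dots> = order_sum_at_0 k (\<lambda>j. eval_fps (A j))"
  proof (rule order_sum_at_0_eq[symmetric])
    show "fps_conv_radius (A j) > 0" if "j < k" for j
      using A[OF that] h by (auto simp: has_q_expansion_iff intro: less_le_trans[of 0 1])
  qed
  finally show ?thesis
    by (simp add: A_def as_function_of_q_def h_def)
qed

end
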